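(* For every integer $q\ge 0$, $$c_{2q} = \sum_{j=0}^q 4^j \binom{2q}{2j} \, c_{q-j}, \qquad c_{2q+1} = 2\sum_{j=0}^q 4^j \binom{2q+1}{2j+1} \, c_{q-j}.$$
   Context: $c_m=\binom{2m}{m}$ ($m\ge 0$) denotes the $m$-th central binomial coefficient. *)

theory Defs
  imports Complex_Main
begin

definition central_binom :: "nat \<Rightarrow> nat"
  where "central_binom m = (2 * m) choose m"

end

theory Submission
  imports Defs "HOL-Computational_Algebra.Polynomial"
begin

text \<open>
  The coefficient of \<open>x ^ n\<close> in \<open>(1 + x) ^ (2 * n) = (2 * x + (1 + x\<^sup>2)) ^ n\<close> is the \<open>n\<close>-th
  central binomial coefficient. Expanding the right-hand side in powers of \<open>2 * x\<close> leaves the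
  middle coefficients of the powers of \<open>1 + x\<^sup>2\<close>, which vanish for odd exponents.
\<close>

text \<open>Binomial theorem, kept general in \<open>d\<close> to serve both 1 + x
  (\<open>d = 1\<close>) and 1 + x^2 (\<open>d = 2\<close>).\<close>

lemma coeff_monom_add_1_power:
  "coeff ((monom 1 d + 1) ^ n) k = (\<Sum>i\<le>n. if d * i = k then of_nat (n choose i) else 0)"
  for n k :: nat
  by (simp add: binomial_ring coeff_sum monom_power of_nat_poly mult.commute if_distrib cong: if_cong)

text \<open>Only even degrees occur; for \<open>m = 2 * h\<close> the term with \<open>i = h\<close>
  survives and gives \<open>2 * h choose h\<close>.\<close>

lemma middle_coeff_one_plus_square_power:
  "coeff ((monom 1 2 + 1 :: nat poly) ^ m) m =
     (if even m then central_binom (m div 2) else 0)"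
proof (cases "even m")
  case True
  then obtain h where h: "m = 2 * h" by blast
  then show ?thesis
    by (simp add: coeff_monom_add_1_power central_binom_def del: One_nat_def)
next
  case False
  then have "2 * i \<noteq> m" for i by auto
  then show ?thesis using False by (simp add: coeff_monom_add_1_power del: One_nat_def)
qed

lemma central_binom_expansion:
  "central_binom n =
     (\<Sum>k\<le>n. (n choose k) * 2 ^ k * (if even (n - k) then central_binom ((n - k) div 2) else 0))"
proof -
  let ?X = "monom 1 1 :: nat poly"
  have square: "(?X + 1)\<^sup>2 = monom 2 1 + (monom 1 2 + 1)"
    by (rule poly_eqI) (simp add: power2_eq_square algebra_simps mult_monom)
  have "central_binom n = coeff ((?X + 1) ^ (2 * n)) n"
    by (simp add: coeff_monom_add_1_power central_binom_def del: One_nat_def)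
  also have "\<dots> = coeff ((monom 2 1 + (monom 1 2 + 1 :: nat poly)) ^ n) n"
    by (simp only: power_mult square)
  \<comment> \<open>The factor (2x)^k moves the wanted degree from \<open>n\<close> to
    \<open>n - k\<close>, which is also the exponent left on 1 + x^2: again a middle
    coefficient.\<close>
  also have "\<dots> = (\<Sum>k\<le>n. (n choose k) * 2 ^ k * coeff ((monom 1 2 + 1 :: nat poly) ^ (n - k)) (n - k))"
    by (simp add: binomial_ring[of "monom 2 1"] coeff_sum monom_power of_nat_poly
        coeff_monom_mult mult.assoc del: One_nat_def)
  finally show ?thesis
    by (simp only: middle_coeff_one_plus_square_power)
qed

theorem mainTheorem12:
  fixes q :: nat
  shows "central_binom (2 * q) =
           (\<Sum>j=0..q. 4 ^ j * ((2 * q) choose (2 * j)) * central_binom (q - j))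
       \<and> central_binom (2 * q + 1) =
           2 * (\<Sum>j=0..q. 4 ^ j * ((2 * q + 1) choose (2 * j + 1)) * central_binom (q - j))"
proof
  let ?t = "\<lambda>n k. (n choose k) * 2 ^ k * (if even (n - k) then central_binom ((n - k) div 2) else 0)"
  \<comment> \<open>Nonzero terms need \<open>n - k\<close> even, so here \<open>k = 2 * j\<close>;
    then \<open>2 ^ k = 4 ^ j\<close> and half of \<open>n - k\<close> is
    \<open>q - j\<close>.\<close>
  have "central_binom (2 * q) = sum (?t (2 * q)) ((\<lambda>j. 2 * j) ` {0..q})"
    unfolding central_binom_expansion[of "2 * q"]
    by (rule sum.mono_neutral_right) (auto simp: image_iff elim!: evenE)
  also have "\<dots> = (\<Sum>j=0..q. 4 ^ j * ((2 * q) choose (2 * j)) * central_binom (q - j))"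
    by (simp add: sum.reindex inj_on_def power_mult flip: diff_mult_distrib2)
       (simp add: mult.commute)
  finally show "central_binom (2 * q) =
      (\<Sum>j=0..q. 4 ^ j * ((2 * q) choose (2 * j)) * central_binom (q - j))" .
  \<comment> \<open>Now \<open>k\<close> must be odd. With \<open>k = 2 * j + 1\<close>, half of
    \<open>n - k\<close> is still \<open>q - j\<close>, while \<open>2 ^ k = 2 * 4 ^ j\<close>
    supplies the outer factor 2.\<close>
  have "central_binom (2 * q + 1) = sum (?t (2 * q + 1)) ((\<lambda>j. 2 * j + 1) ` {0..q})"
    unfolding central_binom_expansion[of "2 * q + 1"]
    by (rule sum.mono_neutral_right) (auto simp: image_iff elim!: oddE)
  also have "\<dots> = 2 * (\<Sum>j=0..q. 4 ^ j * ((2 * q + 1) choose (2 * j + 1)) * central_binom (q - j))"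
    by (simp add: sum.reindex inj_on_def power_mult sum_distrib_left flip: diff_mult_distrib2)
       (simp add: mult_ac)
  finally show "central_binom (2 * q + 1) =
      2 * (\<Sum>j=0..q. 4 ^ j * ((2 * q + 1) choose (2 * j + 1)) * central_binom (q - j))" .
qed

end
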